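(* Let $N\ge 2$, let $X\in\mathbb{R}^{N\times n_x}$, $U\in\mathbb{R}^{N\times n_u}$, $S\in\mathbb{R}^{(N-1)\times n_x}$ and let $\mu\in\mathbb{R}^{n_x}$ be a row vector. Define $\Lambda\in\mathbb{R}^{N\times n_x}$ by $$\Lambda_1=\frac1{w_1}\alpha^{T}S,\qquad \Lambda_{2:N}=W_{2:N}^{-1}S.$$ Then $(X,U,S,\mu)$ satisfies the KKT conditions $$E_{(:,1)}^{T}S=\nabla_{X_1}\langle S,\alpha F_1\rangle-\mu,$$ $$E_{(:,2:N)}^{T}S=\nabla_{X_{2:N}}\langle S,F_{2:N}\rangle+\tilde e_{N-1}\nabla\Phi(X_N),$$ $$0=\nabla_U\langle S,[\,\alpha\;\;I_{N-1}\,]F\rangle$$ of the derivative-like nonlinear program if and only if $$D^{\dagger}\Lambda_{2:N}=-\nabla_X\langle\Lambda,F\rangle+\frac{e_1}{w_1}(\mu-\Lambda_1)+\frac{e_N}{w_N}(\Lambda_N-\nabla\Phi(X_N))$$ and $$0=\nabla_U\langle\Lambda,F\rangle .$$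
   Context: Let $-1=\tau_1<\dots<\tau_N=1$ be the $N$ Legendre-Gauss-Lobatto (LGL) points, i.e. the roots of $(\tau^2-1)\dot P_{N-1}(\tau)$ with $P_{N-1}$ the Legendre polynomial of degree $N-1$; let $L_1,\dots,L_N$ be the Lagrange polynomials of degree $N-1$ supported at these points, $L_j(\tau_i)=\delta_{ij}$. The LGL quadrature weights are $w_j=\int_{-1}^{1}L_j(\tau)\,d\tau>0$, and $W_{2:N}=\mathrm{diag}(w_2,\dots,w_N)$. The matrix $A\in\mathbb{R}^{N\times N}$ has entries $A_{ij}=\int_{-1}^{\tau_i}L_j(\tau)\,d\tau$, and $\tilde A\in\mathbb{R}^{(N-1)\times N}$ is $A$ with its (zero) first row deleted; $\tilde A_{(:,1)}$ is its first column and $\tilde A_{(:,2:N)}$, which is invertible, consists of its remaining columns. Define $$E=[\tilde A_{(:,2:N)}]^{-1}[\,-\mathbf 1\;\;I_{N-1}\,]\in\mathbb{R}^{(N-1)\times N},\qquad \alpha=[\tilde A_{(:,2:N)}]^{-1}\tilde A_{(:,1)}\in\mathbb{R}^{N-1},$$ with components of $\alpha$ denoted $\alpha_1,\dots,\alpha_{N-1}$. The matrix $D^\dagger\in\mathbb{R}^{N\times(N-1)}$ is defined, for $j=1,\dots,N-1$, by $$D^\dagger_{1j}=-\frac{w_{j+1}}{w_1}E_{j1}-\frac{w_{j+1}}{w_1^2}\alpha_j,\qquad D^\dagger_{ij}=-\frac{w_{j+1}}{w_i}E_{ji}+\frac{\delta_{Ni}\delta_{(N-1)j}}{w_N}\quad(i=2,\dots,N).$$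 Let $f:\mathbb{R}^{n_x}\times\mathbb{R}^{n_u}\to\mathbb{R}^{n_x}$ and $\Phi:\mathbb{R}^{n_x}\to\mathbb{R}$ be differentiable. For a matrix $Z$, $Z_i$ denotes its $i$-th row and $Z_{i:j}$ its rows $i$ through $j$; $Z_{(:,i)}$ is column $i$ and $Z_{(:,i:j)}$ columns $i$ through $j$. States and controls are row vectors: $X_i\in\mathbb{R}^{n_x}$, $U_i\in\mathbb{R}^{n_u}$, and $F\in\mathbb{R}^{N\times n_x}$ has rows $F_i=f(X_i,U_i)$. $\langle P,Q\rangle=\mathrm{tr}(P^TQ)$ is the Frobenius inner product. The gradient of a scalar function with respect to a matrix (or to some of its rows) is the matrix of the same shape of partial derivatives, where multipliers ($S$, $\Lambda$) are held constant; thus the $i$-th row of $\nabla_X\langle\Lambda,F\rangle$ is $\Lambda_i\,\partial f/\partial x(X_i,U_i)$. $\nabla\Phi$ is a row vector. $\mathbf 1$ is a column of ones of appropriate length, $e_1,e_N$ are the first and last columns of the $N\times N$ identity, and $\tilde e_{N-1}$ is the last column of the $(N-1)\times(N-1)$ identity $I_{N-1}$. The derivative-like nonlinear program is: minimize $\Phi(X_N)$ over $X,U$ subject to $0=[\,\alpha\;\;I_{N-1}\,]F-EX$ and $X_1=x_0$ (with $x_0$ given). Its Lagrangian is $\Phi(X_N)+\langle S,[\,\alpha\;\;I_{N-1}\,]F-EX\rangle+\langle\mu,x_0-X_1\rangle$. *)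

theory Defs
  imports "HOL-Analysis.Analysis" "HOL-Computational_Algebra.Polynomial"
begin

(* Conventions.  Matrices whose dimensions depend on N are functions of 1-based indices:
   M i j is meaningful for i, j in the evident ranges within {1..N}.
   An m x n_x matrix (X, F, S, Lambda, ...) is a function giving its rows, i in {1..m}. *)

definition row_mult :: "nat \<Rightarrow> (nat \<Rightarrow> nat \<Rightarrow> real) \<Rightarrow> (nat \<Rightarrow> 'v::real_vector) \<Rightarrow> nat \<Rightarrow> 'v" where
  "row_mult n M Z i = (\<Sum>k=1..n. M i k *\<^sub>R Z k)"

definition frobenius :: "nat \<Rightarrow> (nat \<Rightarrow> 'v::real_inner) \<Rightarrow> (nat \<Rightarrow> 'v) \<Rightarrow> real" where
  "frobenius m P Q = (\<Sum>i=1..m. inner (P i) (Q i))"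

(* The analogue of matrix_inv for n x n matrices with a varying dimension n. *)
definition index_matrix_inv :: "nat \<Rightarrow> (nat \<Rightarrow> nat \<Rightarrow> real) \<Rightarrow> nat \<Rightarrow> nat \<Rightarrow> real" where
  "index_matrix_inv n M = (SOME B. \<forall>i\<in>{1..n}. \<forall>j\<in>{1..n}.
      (\<Sum>k=1..n. M i k * B k j) = (if i = j then 1 else 0) \<and>
      (\<Sum>k=1..n. B i k * M k j) = (if i = j then 1 else 0))"

definition grad :: "(real^'k \<Rightarrow> real) \<Rightarrow> real^'k \<Rightarrow> real^'k" where
  "grad g x = (\<chi> k. deriv (\<lambda>h. g (x + h *\<^sub>R axis k 1)) 0)"

(* Row i of the gradient of G with respect to a matrix, at Z. *)
definition matrix_grad ::
    "((nat \<Rightarrow> real^'k) \<Rightarrow> real) \<Rightarrow> (nat \<Rightarrow> real^'k) \<Rightarrow> nat \<Rightarrow> real^'k" where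
  "matrix_grad G Z i = grad (\<lambda>r. G (Z(i := r))) (Z i)"

(* Rodrigues' formula. *)
definition legendre :: "nat \<Rightarrow> real poly" where
  "legendre n = smult (1 / (2 ^ n * fact n)) ((pderiv ^^ n) ([:-1, 0, 1:] ^ n))"

definition lgl_points :: "nat \<Rightarrow> (nat \<Rightarrow> real) \<Rightarrow> bool" where
  "lgl_points N \<tau> \<longleftrightarrow>
     strict_mono_on {1..N} \<tau> \<and> \<tau> 1 = -1 \<and> \<tau> N = 1 \<and>
     \<tau> ` {1..N} = {x. poly ([:-1, 0, 1:] * pderiv (legendre (N - 1))) x = 0}"

definition lagrange :: "nat \<Rightarrow> (nat \<Rightarrow> real) \<Rightarrow> nat \<Rightarrow> real poly" where
  "lagrange N \<tau> j = (\<Prod>i\<in>{1..N} - {j}. smult (1 / (\<tau> j - \<tau> i)) [:- \<tau> i, 1:])"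

definition lgl_weight :: "nat \<Rightarrow> (nat \<Rightarrow> real) \<Rightarrow> nat \<Rightarrow> real" where
  "lgl_weight N \<tau> j = integral {-1..1} (poly (lagrange N \<tau> j))"

definition A_mat :: "nat \<Rightarrow> (nat \<Rightarrow> real) \<Rightarrow> nat \<Rightarrow> nat \<Rightarrow> real" where
  "A_mat N \<tau> i j = integral {-1..\<tau> i} (poly (lagrange N \<tau> j))"

definition A_tilde :: "nat \<Rightarrow> (nat \<Rightarrow> real) \<Rightarrow> nat \<Rightarrow> nat \<Rightarrow> real" where
  "A_tilde N \<tau> i j = A_mat N \<tau> (i + 1) j"

definition A_tilde_inv :: "nat \<Rightarrow> (nat \<Rightarrow> real) \<Rightarrow> nat \<Rightarrow> nat \<Rightarrow> real" where
  "A_tilde_inv N \<tau> = index_matrix_inv (N - 1) (\<lambda>i j. A_tilde N \<tau> i (j + 1))"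

(* The block matrix [v  I]. *)
definition col_id :: "(nat \<Rightarrow> real) \<Rightarrow> nat \<Rightarrow> nat \<Rightarrow> real" where
  "col_id v j i = (if i = 1 then v j else if i = j + 1 then 1 else 0)"

definition E_mat :: "nat \<Rightarrow> (nat \<Rightarrow> real) \<Rightarrow> nat \<Rightarrow> nat \<Rightarrow> real" where
  "E_mat N \<tau> j i = (\<Sum>k=1..N - 1. A_tilde_inv N \<tau> j k * col_id (\<lambda>_. -1) k i)"

definition alpha :: "nat \<Rightarrow> (nat \<Rightarrow> real) \<Rightarrow> nat \<Rightarrow> real" where
  "alpha N \<tau> j = (\<Sum>k=1..N - 1. A_tilde_inv N \<tau> j k * A_tilde N \<tau> k 1)"

definition D_dagger :: "nat \<Rightarrow> (nat \<Rightarrow> real) \<Rightarrow> nat \<Rightarrow> nat \<Rightarrow> real" where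
  "D_dagger N \<tau> i j = (let w = lgl_weight N \<tau> in
     if i = 1 then - (w (j + 1) / w 1) * E_mat N \<tau> j 1 - w (j + 1) / (w 1)\<^sup>2 * alpha N \<tau> j
     else - (w (j + 1) / w i) * E_mat N \<tau> j i + (if i = N \<and> j = N - 1 then 1 / w N else 0))"

definition F_mat :: "((real^'x) \<times> (real^'u) \<Rightarrow> real^'x) \<Rightarrow> (nat \<Rightarrow> real^'x) \<Rightarrow> (nat \<Rightarrow> real^'u) \<Rightarrow> nat \<Rightarrow> real^'x" where
  "F_mat f X U i = f (X i, U i)"

end

theory Submission
  imports Defs
begin

text \<open>
  Row by row, both systems say the same thing up to a nonzero factor.  Since \<open>S j\<close> equals
  \<open>w (j + 1)\<close> times \<open>\<Lambda> (j + 1)\<close> and \<open>\<Sum>j. \<alpha> j S j\<close> equals \<open>w 1 \<Lambda> 1\<close>, the quantity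
  \<open>\<langle>S, [\<alpha> I] F\<rangle>\<close> is the quadrature sum \<open>\<Sum>i. w i \<langle>\<Lambda> i, F i\<rangle>\<close>.  Because \<open>F i\<close> depends
  only on the \<open>i\<close>-th rows of the state and of the control, each gradient in the first-order
  conditions is \<open>w i\<close> times the corresponding row of the gradient of \<open>\<langle>\<Lambda>, F\<rangle>\<close>
  (\<open>matrix_grad_weighted_sum\<close>).  The matrix \<open>D_dagger\<close> is built so that its \<open>i\<close>-th row applied
  to \<open>\<Lambda>\<close> gives \<open>- 1 / w i\<close> times the \<open>i\<close>-th row of the transpose of \<open>E\<close> applied to \<open>S\<close>,
  up to corrections in the first and last row that cancel the terms \<open>\<Lambda> 1 / w 1\<close> and
  \<open>\<Lambda> N / w N\<close> of the right-hand side.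

  What makes the rescaling reversible is that the quadrature weights do not vanish
  (\<open>lgl_weight_pos\<close>).  Write the Lagrange polynomial \<open>L\<close> at the node \<open>t\<close> as \<open>v u\<close>, where \<open>v\<close>
  collects the factors of the end points and \<open>u\<close> those of the interior nodes.  Then
  \<open>v u^2 - v u = L (u - 1)\<close> and \<open>u - 1\<close> is divisible by \<open>x - t\<close>, so the difference is the node
  polynomial times a polynomial that vanishes or has degree less than \<open>N - 2\<close>.  The node polynomial is a multiple
  of \<open>(x^2 - 1) P'\<close> with \<open>P\<close> the Legendre polynomial of degree \<open>N - 1\<close>, which Rodrigues' formula
  and integration by parts show to be orthogonal to such polynomials
  (\<open>legendre_lobatto_orthogonal\<close>).  Hence the weight is the integral of \<open>v u^2\<close>, which is
  nonnegative on \<open>[-1, 1]\<close> and equal to 1 at \<open>t\<close>.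
\<close>

section \<open>Orthogonality of the Legendre--Lobatto polynomial\<close>

lemma poly_integrable: "poly (p :: real poly) integrable_on {a..b}"
  by (intro integrable_continuous_real continuous_intros)

lemma integral_poly_pderiv:
  fixes p :: "real poly"
  assumes "a \<le> b"
  shows "integral {a..b} (poly (pderiv p)) = poly p b - poly p a"
proof (rule integral_unique, rule fundamental_theorem_of_calculus[OF assms])
  fix x
  show "(poly p has_vector_derivative poly (pderiv p) x) (at x within {a..b})"
    using poly_DERIV[of p x]
    by (simp add: has_real_derivative_iff_has_vector_derivative has_vector_derivative_at_within)
qed

lemma integral_poly_by_parts:
  fixes p q :: "real poly"
  assumes "a \<le> b" "poly (p * q) a = 0" "poly (p * q) b = 0"
  shows "integral {a..b} (poly (pderiv p * q)) = - integral {a..b} (poly (p * pderiv q))"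
proof -
  have "integral {a..b} (poly (pderiv p * q)) + integral {a..b} (poly (p * pderiv q))
      = integral {a..b} (\<lambda>x. poly (pderiv p * q) x + poly (p * pderiv q) x)"
    by (rule Henstock_Kurzweil_Integration.integral_add[symmetric]) (rule poly_integrable)+
  also have "(\<lambda>x. poly (pderiv p * q) x + poly (p * pderiv q) x) = poly (pderiv (p * q))"
    by (auto simp: pderiv_mult algebra_simps)
  finally show ?thesis
    using integral_poly_pderiv[OF assms(1), of "p * q"] assms(2,3) by linarith
qed

text \<open>Each integration by parts moves one derivative onto \<open>s\<close>, until \<open>s\<close> is annihilated.\<close>
lemma integral_higher_pderiv_mult_eq_0:
  fixes g s :: "real poly"
  assumes "a \<le> b"
    and "\<And>j. j < k \<Longrightarrow> poly ((pderiv ^^ j) g) a = 0"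
    and "\<And>j. j < k \<Longrightarrow> poly ((pderiv ^^ j) g) b = 0"
    and "(pderiv ^^ k) s = 0"
  shows "integral {a..b} (poly ((pderiv ^^ k) g * s)) = 0"
  using assms(2-)
proof (induction k arbitrary: s)
  case 0
  then have "poly ((pderiv ^^ 0) g * s) = (\<lambda>x. 0)"
    by auto
  then show ?case
    by simp
next
  case (Suc k)
  have "integral {a..b} (poly (pderiv ((pderiv ^^ k) g) * s))
      = - integral {a..b} (poly ((pderiv ^^ k) g * pderiv s))"
    using Suc.prems by (intro integral_poly_by_parts assms(1)) auto
  also have "integral {a..b} (poly ((pderiv ^^ k) g * pderiv s)) = 0"
    using Suc.prems by (intro Suc.IH) (auto simp: funpow_swap1)
  finally show ?case
    by simp
qed

lemma linear_power_dvd_pderiv: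
  fixes p :: "real poly"
  assumes "[:-a, 1:] ^ Suc m dvd p"
  shows "[:-a, 1:] ^ m dvd pderiv p"
proof -
  obtain r where r: "p = [:-a, 1:] ^ Suc m * r"
    using assms by (auto elim: dvdE)
  have "pderiv p = [:-a, 1:] ^ m * ([:-a, 1:] * pderiv r + smult (of_nat (Suc m)) r)"
    unfolding r pderiv_mult pderiv_power_Suc by (simp add: pderiv_pCons algebra_simps)
  then show ?thesis
    by simp
qed

lemma linear_power_dvd_higher_pderiv:
  fixes p :: "real poly"
  assumes "[:-a, 1:] ^ (m + k) dvd p"
  shows "[:-a, 1:] ^ m dvd (pderiv ^^ k) p"
  using assms
proof (induction k arbitrary: m)
  case (Suc k)
  from Suc.prems have "[:-a, 1:] ^ Suc m dvd (pderiv ^^ k) p"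
    by (intro Suc.IH) simp
  then show ?case
    using linear_power_dvd_pderiv by simp
qed simp

lemma poly_higher_pderiv_rodrigues_eq_0:
  fixes a :: real
  assumes "j < n" "a = 1 \<or> a = -1"
  shows "poly ((pderiv ^^ j) ([:-1, 0, 1:] ^ n)) a = 0"
proof -
  have "[:-1, 0, 1:] = [:-a, 1:] * [:a, 1:]"
    using assms(2) by auto
  then have "[:-a, 1:] ^ n dvd [:-1, 0, 1:] ^ n"
    by (simp only: dvd_power_same dvd_triv_left)
  moreover have "[:-a, 1:] ^ (1 + j) dvd [:-a, 1:] ^ n"
    using assms(1) by (intro le_imp_power_dvd) simp
  ultimately have "[:-a, 1:] ^ (1 + j) dvd [:-1, 0, 1:] ^ n"
    by (rule dvd_trans[rotated])
  then have "[:-a, 1:] ^ 1 dvd (pderiv ^^ j) ([:-1, 0, 1:] ^ n)"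
    by (rule linear_power_dvd_higher_pderiv)
  then show ?thesis
    by (simp add: poly_eq_0_iff_dvd)
qed

text \<open>
  By Rodrigues' formula, \<open>(x^2 - 1) P' r\<close> is up to a constant the derivative of order \<open>n + 1\<close> of
  \<open>(x^2 - 1)^n\<close> times \<open>s = (x^2 - 1) r\<close>, and \<open>s\<close> has degree at most \<open>n\<close>.  The derivative of order
  \<open>n\<close> does not vanish at the end points, so the factor \<open>x^2 - 1\<close> of \<open>s\<close> is what kills the first
  boundary term; in the remaining \<open>n\<close> integrations by parts the lower derivatives do so.
\<close>
lemma legendre_lobatto_orthogonal:
  fixes r :: "real poly"
  assumes "r = 0 \<or> degree r + 1 < n"
  shows "integral {-1..1} (poly ([:-1, 0, 1:] * pderiv (legendre n) * r)) = 0"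
proof (cases "r = 0")
  case False
  define g :: "real poly" where "g = [:-1, 0, 1:] ^ n"
  define s :: "real poly" where "s = [:-1, 0, 1:] * r"
  define c :: real where "c = 1 / (2 ^ n * fact n)"
  have deg: "degree s < n + 1"
    using False assms degree_mult_le[of "[:-1, 0, 1:]" r] by (simp add: s_def)
  have "(pderiv ^^ n) (pderiv s) = 0"
  proof -
    have "degree ((pderiv ^^ n) s) = 0"
      using deg by (simp add: degree_higher_pderiv)
    then have "pderiv ((pderiv ^^ n) s) = 0"
      by (simp add: pderiv_eq_0_iff)
    then show ?thesis
      by (simp add: funpow_swap1)
  qed
  then have "integral {-1..1} (poly ((pderiv ^^ n) g * pderiv s)) = 0"
    by (intro integral_higher_pderiv_mult_eq_0)
       (auto simp: g_def poly_higher_pderiv_rodrigues_eq_0)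
  moreover have "integral {-1..1} (poly (pderiv ((pderiv ^^ n) g) * s))
      = - integral {-1..1} (poly ((pderiv ^^ n) g * pderiv s))"
    by (rule integral_poly_by_parts) (auto simp: s_def)
  moreover have "poly ([:-1, 0, 1:] * pderiv (legendre n) * r)
      = (\<lambda>x. c * poly (pderiv ((pderiv ^^ n) g) * s) x)"
    by (rule ext) (simp add: legendre_def g_def s_def c_def pderiv_smult algebra_simps)
  ultimately show ?thesis
    by (simp only: integral_mult_right)
next
  case True
  then have "poly ([:-1, 0, 1:] * pderiv (legendre n) * r) = (\<lambda>x. 0)"
    by auto
  then show ?thesis
    by simp
qed

section \<open>Positivity of the quadrature weights\<close>

text \<open>
  The hypothesis on the nodes gives \<open>N\<close> distinct roots of a nonzero polynomial of degree at
  most \<open>N\<close>, so all of them are simple and there are no others.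
\<close>
lemma lgl_node_polynomial:
  assumes "N \<ge> 2" "lgl_points N \<tau>"
  obtains c where "c \<noteq> 0"
    "[:-1, 0, 1:] * pderiv (legendre (N - 1)) = smult c (\<Prod>i\<in>{1..N}. [:- \<tau> i, 1:])"
proof -
  define g where "g = [:-1, 0, 1:] * pderiv (legendre (N - 1))"
  define p where "p = (\<Prod>i\<in>{1..N}. [:- \<tau> i, 1:])"
  have roots: "\<tau> ` {1..N} = {x. poly g x = 0}"
    using assms(2) by (simp add: lgl_points_def g_def)
  have inj: "inj_on \<tau> {1..N}"
    using assms(2) by (simp add: lgl_points_def strict_mono_on_imp_inj_on)
  have "g \<noteq> 0"
  proof
    assume "g = 0"
    then have "\<tau> ` {1..N} = UNIV"
      using roots by auto
    then show False
      using infinite_UNIV_char_0 finite_imageI[of "{1..N}" \<tau>] by (metis finite_atLeastAtMost)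
  qed
  have "degree (legendre (N - 1)) \<le> 2 * (N - 1) - (N - 1)"
    unfolding legendre_def
    by (rule order.trans[OF degree_smult_le])
       (simp add: degree_higher_pderiv degree_power_eq)
  then have deg_g: "degree g \<le> N"
    using assms(1) degree_mult_le[of "[:-1, 0, 1:]" "pderiv (legendre (N - 1))"]
    by (simp add: g_def degree_pderiv)
  have deg_p: "degree p = N"
    unfolding p_def by (subst degree_prod_sum_eq) auto
  have "lead_coeff p = 1"
    unfolding p_def lead_coeff_prod by simp
  then have coeff_p: "coeff p N = 1"
    using deg_p by simp
  have g_eq: "g = smult (coeff g N) p"
  proof (rule poly_eqI_degree_lead_coeff[where n = N and A = "\<tau> ` {1..N}"])
    show "coeff g N = coeff (smult (coeff g N) p) N"
      using coeff_p by simp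
    show "N \<le> card (\<tau> ` {1..N})"
      using inj by (simp add: card_image)
    show "degree (smult (coeff g N) p) \<le> N"
      using deg_p degree_smult_le[of "coeff g N" p] by simp
    fix z
    assume z: "z \<in> \<tau> ` {1..N}"
    then have "poly p z = 0"
      unfolding p_def poly_prod by (auto intro!: prod_zero)
    then show "poly g z = poly (smult (coeff g N) p) z"
      using z roots by auto
  qed (rule deg_g)
  moreover have "coeff g N \<noteq> 0"
    using g_eq \<open>g \<noteq> 0\<close> by (metis smult_0_left)
  ultimately show thesis
    using that unfolding g_def p_def by blast
qed

text \<open>
  The end point factors \<open>v\<close> need not be squared, since they keep their sign on \<open>[-1, 1]\<close>.  Squaring
  them as well would raise the degree beyond what the quadrature rule integrates exactly.
\<close>
lemma lgl_weight_pos: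
  assumes N: "N \<ge> 2" and lgl: "lgl_points N \<tau>" and j: "j \<in> {1..N}"
  shows "lgl_weight N \<tau> j > 0"
proof -
  define l where "l i = smult (1 / (\<tau> j - \<tau> i)) [:- \<tau> i, 1:]" for i
  define u where "u = (\<Prod>i\<in>{2..N - 1} - {j}. l i)"
  define v where "v = (\<Prod>i\<in>{1, N} - {j}. l i)"
  define p where "p = (\<Prod>i\<in>{1..N}. [:- \<tau> i, 1:])"
  have mono: "strict_mono_on {1..N} \<tau>" and ends: "\<tau> 1 = -1" "\<tau> N = 1"
    using lgl by (auto simp: lgl_points_def)
  have inj: "inj_on \<tau> {1..N}"
    using mono by (rule strict_mono_on_imp_inj_on)
  have range: "\<tau> i \<in> {-1..1}" if "i \<in> {1..N}" for i
    using strict_mono_on_leD[OF mono, of 1 i] strict_mono_on_leD[OF mono, of i N] that N ends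
    by auto
  have distinct: "\<tau> i \<noteq> \<tau> j" if "i \<in> {1..N} - {j}" for i
    using inj_onD[OF inj] that j by blast
  have l_one: "poly (l i) (\<tau> j) = 1" if "i \<in> {1..N} - {j}" for i
    using distinct[OF that] by (simp add: l_def divide_simps)
  have lag: "lagrange N \<tau> j = v * u"
  proof -
    have "{1..N} - {j} = ({1, N} - {j}) \<union> ({2..N - 1} - {j})"
      using N by auto
    moreover have "({1, N} - {j}) \<inter> ({2..N - 1} - {j}) = {}"
      using N by auto
    ultimately show ?thesis
      unfolding lagrange_def u_def v_def l_def by (simp add: prod.union_disjoint)
  qed
  have u_one: "poly u (\<tau> j) = 1"
    unfolding u_def poly_prod by (intro prod.neutral ballI l_one) auto
  have v_one: "poly v (\<tau> j) = 1"
    unfolding v_def poly_prod by (intro prod.neutral ballI l_one) (use N in auto)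
  have v_nonneg: "poly v x \<ge> 0" if x: "x \<in> {-1..1}" for x
    unfolding v_def poly_prod
  proof (rule prod_nonneg)
    fix i
    assume i: "i \<in> {1, N} - {j}"
    then have "poly (l i) x = (x - \<tau> i) / (\<tau> j - \<tau> i)"
      by (simp add: l_def diff_divide_distrib)
    moreover have "\<tau> i = -1 \<or> \<tau> i = 1"
      using i ends by auto
    ultimately show "poly (l i) x \<ge> 0"
      using x range[OF j] by (auto intro: divide_nonneg_nonneg divide_nonpos_nonpos)
  qed
  have deg_u: "degree u \<le> N - 2"
  proof -
    have "degree u \<le> (\<Sum>i\<in>{2..N - 1} - {j}. degree (l i))"
      unfolding u_def using degree_prod_sum_le[of "{2..N - 1} - {j}" l] by (simp add: o_def)
    also have "\<dots> \<le> (\<Sum>i\<in>{2..N - 1} - {j}. 1)"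
      by (rule sum_mono) (simp add: l_def)
    also have "\<dots> = card ({2..N - 1} - {j})"
      by simp
    also have "\<dots> \<le> card {2..N - 1}"
      by (rule card_mono) auto
    finally show ?thesis
      by simp
  qed
  have "[:- \<tau> j, 1:] dvd u - 1"
    using u_one by (simp add: poly_eq_0_iff_dvd[symmetric])
  then obtain r where r: "u - 1 = [:- \<tau> j, 1:] * r"
    by (auto elim: dvdE)
  have deg_r: "r = 0 \<or> degree r + 1 < N - 1"
  proof (cases "r = 0")
    case False
    then have "degree (u - 1) = degree r + 1"
      unfolding r by (subst degree_mult_eq) auto
    moreover have "degree (u - 1) \<le> N - 2"
      using deg_u by (intro degree_diff_le) auto
    ultimately show ?thesis
      using N by linarith
  qed simp
  obtain d where d: "lagrange N \<tau> j * [:- \<tau> j, 1:] = smult d p"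
  proof -
    have "p = [:- \<tau> j, 1:] * (\<Prod>i\<in>{1..N} - {j}. [:- \<tau> i, 1:])"
      unfolding p_def using j by (simp add: prod.remove)
    then have "lagrange N \<tau> j * [:- \<tau> j, 1:] = smult (\<Prod>i\<in>{1..N} - {j}. 1 / (\<tau> j - \<tau> i)) p"
      unfolding lagrange_def prod_smult by (simp add: mult.commute)
    then show thesis
      by (rule that)
  qed
  obtain c where c: "c \<noteq> 0" "[:-1, 0, 1:] * pderiv (legendre (N - 1)) = smult c p"
    using lgl_node_polynomial[OF N lgl] unfolding p_def by blast
  \<comment> \<open>Squaring \<open>u\<close> makes the integrand nonnegative and leaves the integral unchanged.\<close>
  have "v * u\<^sup>2 - lagrange N \<tau> j = lagrange N \<tau> j * (u - 1)"
    by (simp add: lag power2_eq_square algebra_simps)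
  also have "\<dots> = smult d (p * r)"
    unfolding r by (simp only: mult.assoc[symmetric] d mult_smult_left)
  also have "\<dots> = smult (d / c) ([:-1, 0, 1:] * pderiv (legendre (N - 1)) * r)"
    unfolding c(2) using c(1) by simp
  finally have diff: "poly (v * u\<^sup>2) = (\<lambda>x. poly (lagrange N \<tau> j) x
      + (d / c) * poly ([:-1, 0, 1:] * pderiv (legendre (N - 1)) * r) x)"
    by (metis (no_types, opaque_lifting) add.commute diff_add_cancel poly_add poly_smult)
  have "integral {-1..1} (poly (v * u\<^sup>2)) = lgl_weight N \<tau> j
      + integral {-1..1} (\<lambda>x. (d / c) * poly ([:-1, 0, 1:] * pderiv (legendre (N - 1)) * r) x)"
    unfolding diff lgl_weight_def
    by (intro Henstock_Kurzweil_Integration.integral_add poly_integrable integrable_on_mult_right)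
  also have "\<dots> = lgl_weight N \<tau> j"
    by (simp only: integral_mult_right legendre_lobatto_orthogonal[OF deg_r] mult_zero_right
        add_0_right)
  finally have weight: "lgl_weight N \<tau> j = integral {-1..1} (poly (v * u\<^sup>2))"
    by simp
  have nonneg: "poly (v * u\<^sup>2) x \<ge> 0" if "x \<in> {-1..1}" for x
    using v_nonneg[OF that] by simp
  have "integral {-1..1} (poly (v * u\<^sup>2)) \<ge> 0"
    using nonneg by (intro integral_nonneg poly_integrable) auto
  moreover have "integral {-1..1} (poly (v * u\<^sup>2)) \<noteq> 0"
  proof
    assume "integral {-1..1} (poly (v * u\<^sup>2)) = 0"
    moreover have "continuous_on {-1..1} (poly (v * u\<^sup>2))"
      by (rule continuous_at_imp_continuous_on) (intro ballI poly_isCont)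
    ultimately have "\<forall>x\<in>{-1..1}. poly (v * u\<^sup>2) x = 0"
      using integral_eq_0_iff[of "-1" 1 "poly (v * u\<^sup>2)", OF _ _ nonneg] by simp
    then have "poly (v * u\<^sup>2) (\<tau> j) = 0"
      using range[OF j] by (rule bspec)
    then show False
      using u_one v_one by simp
  qed
  ultimately show ?thesis
    using weight by linarith
qed

section \<open>Gradients of separable functions\<close>

lemma has_real_derivative_grad_direction:
  fixes g :: "real^'k \<Rightarrow> 'v::real_inner"
  assumes "g differentiable at x"
  obtains D where "((\<lambda>h. inner b (g (x + h *\<^sub>R axis k 1))) has_real_derivative D) (at 0)"
proof -
  have "(\<lambda>h. g (x + h *\<^sub>R axis k 1)) differentiable at (0::real)"
  proof (rule differentiable_compose[of g])
    show "(\<lambda>h. x + h *\<^sub>R axis k 1) differentiable at (0::real)"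
      by (intro derivative_intros)
  qed (simp add: assms)
  then have "(\<lambda>h. inner b (g (x + h *\<^sub>R axis k 1))) differentiable at (0::real)"
    by (intro differentiable_inner differentiable_const)
  then show thesis
    using that by (auto simp: real_differentiable_def)
qed

text \<open>
  Only the summand \<open>i\<close> varies with row \<open>i\<close>.  Differentiability serves to pull out the factor \<open>c i\<close>:
  where a derivative fails to exist, \<open>deriv\<close> has an unspecified value, which need not scale.
\<close>
lemma matrix_grad_weighted_sum:
  fixes Z :: "nat \<Rightarrow> real^'k" and \<Lambda> :: "nat \<Rightarrow> 'v::real_inner"
  assumes "finite K" "i \<in> K" "g i differentiable at (Z i)"
  shows "matrix_grad (\<lambda>Y. \<Sum>k\<in>K. c k * inner (\<Lambda> k) (g k (Y k))) Z i
       = c i *\<^sub>R grad (\<lambda>r. inner (\<Lambda> i) (g i r)) (Z i)"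
proof -
  have split: "(\<Sum>k\<in>K. c k * inner (\<Lambda> k) (g k ((Z(i := r)) k)))
      = c i * inner (\<Lambda> i) (g i r) + (\<Sum>k\<in>K - {i}. c k * inner (\<Lambda> k) (g k (Z k)))" for r
    using assms(1,2) by (simp add: sum.remove)
  show ?thesis
    unfolding matrix_grad_def split grad_def vec_eq_iff
  proof
    fix m
    obtain D where D:
      "((\<lambda>h. inner (\<Lambda> i) (g i (Z i + h *\<^sub>R axis m 1))) has_real_derivative D) (at 0)"
      using has_real_derivative_grad_direction[OF assms(3)] by blast
    have "((\<lambda>h. c i * inner (\<Lambda> i) (g i (Z i + h *\<^sub>R axis m 1))
        + (\<Sum>k\<in>K - {i}. c k * inner (\<Lambda> k) (g k (Z k)))) has_real_derivative c i * D) (at 0)"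
      using DERIV_add[OF DERIV_cmult[OF D] DERIV_const] by simp
    then show "(\<chi> l. deriv (\<lambda>h. c i * inner (\<Lambda> i) (g i (Z i + h *\<^sub>R axis l 1))
          + (\<Sum>k\<in>K - {i}. c k * inner (\<Lambda> k) (g k (Z k)))) 0) $ m
        = (c i *\<^sub>R (\<chi> l. deriv (\<lambda>h. inner (\<Lambda> i) (g i (Z i + h *\<^sub>R axis l 1))) 0)) $ m"
      using D by (simp add: DERIV_imp_deriv)
  qed
qed

section \<open>Equivalence of the optimality systems\<close>

lemma sum_split_first:
  fixes g :: "nat \<Rightarrow> 'a::comm_monoid_add"
  assumes "N \<ge> 1"
  shows "(\<Sum>k=1..N. g k) = g 1 + (\<Sum>k=2..N. g k)"
  using sum.atLeast_Suc_atMost[of 1 N g] assms by (simp add: numeral_2_eq_2)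

theorem mainTheorem2:
  fixes N :: nat and \<tau> w \<alpha> :: "nat \<Rightarrow> real" and E :: "nat \<Rightarrow> nat \<Rightarrow> real"
    and f :: "(real^'x) \<times> (real^'u) \<Rightarrow> real^'x" and \<Phi> :: "real^'x \<Rightarrow> real"
    and X S \<Lambda> :: "nat \<Rightarrow> real^'x" and U :: "nat \<Rightarrow> real^'u" and \<mu> :: "real^'x"
  assumes N: "N \<ge> 2"
    and lgl: "lgl_points N \<tau>"
    and f_diff: "f differentiable_on UNIV"
    and Phi_diff: "\<Phi> differentiable_on UNIV"
    and w: "w = lgl_weight N \<tau>"
    and alpha: "\<alpha> = alpha N \<tau>"
    and E: "E = E_mat N \<tau>"
    and Lambda_1: "\<Lambda> 1 = (1 / w 1) *\<^sub>R (\<Sum>j=1..N - 1. \<alpha> j *\<^sub>R S j)"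
    and Lambda_2N: "\<And>j. j \<in> {1..N - 1} \<Longrightarrow> \<Lambda> (j + 1) = (1 / w (j + 1)) *\<^sub>R S j"
  shows
    "((\<Sum>j=1..N - 1. E j 1 *\<^sub>R S j)
        = matrix_grad (\<lambda>Y. frobenius (N - 1) S (\<lambda>j. \<alpha> j *\<^sub>R F_mat f Y U 1)) X 1 - \<mu>
      \<and> (\<forall>i\<in>{1..N - 1}.
          row_mult (N - 1) (\<lambda>i j. E j (i + 1)) S i
            = matrix_grad (\<lambda>Y. frobenius (N - 1) S (\<lambda>j. F_mat f Y U (j + 1))) X (i + 1)
              + (if i = N - 1 then grad \<Phi> (X N) else 0))
      \<and> (\<forall>i\<in>{1..N}.
          0 = matrix_grad (\<lambda>V. frobenius (N - 1) S (row_mult N (col_id \<alpha>) (F_mat f X V))) U i))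
    \<longleftrightarrow>
     ((\<forall>i\<in>{1..N}.
          row_mult (N - 1) (D_dagger N \<tau>) (\<lambda>j. \<Lambda> (j + 1)) i
            = - matrix_grad (\<lambda>Y. frobenius N \<Lambda> (F_mat f Y U)) X i
              + (if i = 1 then (1 / w 1) *\<^sub>R (\<mu> - \<Lambda> 1) else 0)
              + (if i = N then (1 / w N) *\<^sub>R (\<Lambda> N - grad \<Phi> (X N)) else 0))
      \<and> (\<forall>i\<in>{1..N}.
          0 = matrix_grad (\<lambda>V. frobenius N \<Lambda> (F_mat f X V)) U i))"
proof -
  define GX where "GX i = grad (\<lambda>r. inner (\<Lambda> i) (f (r, U i))) (X i)" for i
  define GU where "GU i = grad (\<lambda>r. inner (\<Lambda> i) (f (X i, r))) (U i)" for i
  have w_ne: "w i \<noteq> 0" if "i \<in> {1..N}" for i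
    using lgl_weight_pos[OF N lgl that] w by simp
  have S_eq: "S j = w (j + 1) *\<^sub>R \<Lambda> (j + 1)" if "j \<in> {1..N - 1}" for j
  proof -
    have "j + 1 \<in> {1..N}"
      using that by auto
    then show ?thesis
      using w_ne unfolding Lambda_2N[OF that] by simp
  qed
  have alpha_S: "(\<Sum>j=1..N - 1. \<alpha> j *\<^sub>R S j) = w 1 *\<^sub>R \<Lambda> 1"
    using Lambda_1 w_ne[of 1] N by simp

  have f_at: "f differentiable at z" for z
    using f_diff unfolding differentiable_on_def by blast
  have fx: "(\<lambda>r. f (r, b)) differentiable at a" for a b
    by (rule differentiable_compose[OF f_at]) simp
  have fu: "(\<lambda>r. f (a, r)) differentiable at b" for a b
    by (rule differentiable_compose[OF f_at]) simp

  have first_row: "frobenius (N - 1) S (\<lambda>j. \<alpha> j *\<^sub>R a) = w 1 * inner (\<Lambda> 1) a" for a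
  proof -
    have "frobenius (N - 1) S (\<lambda>j. \<alpha> j *\<^sub>R a) = inner (\<Sum>j=1..N - 1. \<alpha> j *\<^sub>R S j) a"
      by (simp add: frobenius_def inner_sum_left)
    then show ?thesis
      by (simp only: alpha_S inner_scaleR_left)
  qed
  have other_rows: "frobenius (N - 1) S (\<lambda>j. G (j + 1)) = (\<Sum>k=2..N. w k * inner (\<Lambda> k) (G k))"
    for G
  proof -
    have "frobenius (N - 1) S (\<lambda>j. G (j + 1))
        = (\<Sum>j=1..N - 1. w (j + 1) * inner (\<Lambda> (j + 1)) (G (j + 1)))"
      unfolding frobenius_def by (rule sum.cong) (simp_all add: S_eq del: One_nat_def)
    also have "\<dots> = (\<Sum>k=1 + 1..N - 1 + 1. w k * inner (\<Lambda> k) (G k))"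
      by (rule sum.shift_bounds_cl_nat_ivl[symmetric])
    finally show ?thesis
      using N by (simp add: numeral_2_eq_2)
  qed
  have all_rows: "frobenius (N - 1) S (row_mult N (col_id \<alpha>) G)
      = (\<Sum>k=1..N. w k * inner (\<Lambda> k) (G k))" for G
  proof -
    have row: "row_mult N (col_id \<alpha>) G j = \<alpha> j *\<^sub>R G 1 + G (j + 1)" if "j \<in> {1..N - 1}" for j
    proof -
      have "row_mult N (col_id \<alpha>) G j
          = \<alpha> j *\<^sub>R G 1 + (\<Sum>k=2..N. col_id \<alpha> j k *\<^sub>R G k)"
        unfolding row_mult_def using N by (subst sum_split_first) (auto simp: col_id_def)
      also have "(\<Sum>k=2..N. col_id \<alpha> j k *\<^sub>R G k)
          = (\<Sum>k=2..N. if k = j + 1 then G k else 0)"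
        by (rule sum.cong) (auto simp: col_id_def)
      also have "\<dots> = G (j + 1)"
        using that by auto
      finally show ?thesis .
    qed
    have "frobenius (N - 1) S (row_mult N (col_id \<alpha>) G)
        = frobenius (N - 1) S (\<lambda>j. \<alpha> j *\<^sub>R G 1) + frobenius (N - 1) S (\<lambda>j. G (j + 1))"
      unfolding frobenius_def sum.distrib[symmetric]
      by (rule sum.cong) (simp_all add: row inner_add_right del: One_nat_def)
    then show ?thesis
      using N unfolding first_row other_rows by (subst sum_split_first) simp_all
  qed

  have grad_X_1: "matrix_grad (\<lambda>Y. frobenius (N - 1) S (\<lambda>j. \<alpha> j *\<^sub>R F_mat f Y U 1)) X 1
      = w 1 *\<^sub>R GX 1"
    using matrix_grad_weighted_sum[of "{1}" 1 "\<lambda>k r. f (r, U k)" X w \<Lambda>] fx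
    unfolding first_row F_mat_def GX_def by simp
  have grad_X: "matrix_grad (\<lambda>Y. frobenius (N - 1) S (\<lambda>j. F_mat f Y U (j + 1))) X (i + 1)
      = w (i + 1) *\<^sub>R GX (i + 1)" if "i \<in> {1..N - 1}" for i
  proof -
    have "i + 1 \<in> {2..N}"
      using that by auto
    then show ?thesis
      using matrix_grad_weighted_sum[of "{2..N}" "i + 1" "\<lambda>k r. f (r, U k)" X w \<Lambda>] fx
      unfolding other_rows[of "F_mat f Y U" for Y] unfolding F_mat_def GX_def by simp
  qed
  have grad_U: "matrix_grad (\<lambda>V. frobenius (N - 1) S (row_mult N (col_id \<alpha>) (F_mat f X V))) U i
      = w i *\<^sub>R GU i" if "i \<in> {1..N}" for i
    using matrix_grad_weighted_sum[of "{1..N}" i "\<lambda>k r. f (X k, r)" U w \<Lambda>] fu that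
    unfolding all_rows F_mat_def GU_def by simp
  have grad_X': "matrix_grad (\<lambda>Y. frobenius N \<Lambda> (F_mat f Y U)) X i = GX i"
    if "i \<in> {1..N}" for i
    using matrix_grad_weighted_sum[of "{1..N}" i "\<lambda>k r. f (r, U k)" X "\<lambda>_. 1" \<Lambda>] fx that
    unfolding frobenius_def F_mat_def GX_def by simp
  have grad_U': "matrix_grad (\<lambda>V. frobenius N \<Lambda> (F_mat f X V)) U i = GU i"
    if "i \<in> {1..N}" for i
    using matrix_grad_weighted_sum[of "{1..N}" i "\<lambda>k r. f (X k, r)" U "\<lambda>_. 1" \<Lambda>] fu that
    unfolding frobenius_def F_mat_def GU_def by simp

  have D_1: "row_mult (N - 1) (D_dagger N \<tau>) (\<lambda>j. \<Lambda> (j + 1)) 1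
      = - (1 / w 1) *\<^sub>R (\<Sum>j=1..N - 1. E j 1 *\<^sub>R S j) - (1 / w 1) *\<^sub>R \<Lambda> 1"
  proof -
    have "row_mult (N - 1) (D_dagger N \<tau>) (\<lambda>j. \<Lambda> (j + 1)) 1
        = (\<Sum>j=1..N - 1. - (1 / w 1) *\<^sub>R (E j 1 *\<^sub>R S j) - (1 / (w 1)\<^sup>2) *\<^sub>R (\<alpha> j *\<^sub>R S j))"
      unfolding row_mult_def
      by (rule sum.cong)
         (simp_all add: S_eq D_dagger_def Let_def w[symmetric] E[symmetric] alpha[symmetric]
           scaleR_left_diff_distrib mult.commute del: One_nat_def)
    also have "\<dots> = - (1 / w 1) *\<^sub>R (\<Sum>j=1..N - 1. E j 1 *\<^sub>R S j)
        - (1 / (w 1)\<^sup>2) *\<^sub>R (\<Sum>j=1..N - 1. \<alpha> j *\<^sub>R S j)"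
      unfolding sum_subtractf scaleR_sum_right ..
    finally show ?thesis
      unfolding alpha_S using w_ne[of 1] N by (simp add: power2_eq_square)
  qed
  have D_i: "row_mult (N - 1) (D_dagger N \<tau>) (\<lambda>j. \<Lambda> (j + 1)) (i + 1)
      = - (1 / w (i + 1)) *\<^sub>R row_mult (N - 1) (\<lambda>i j. E j (i + 1)) S i
        + (if i = N - 1 then (1 / w N) *\<^sub>R \<Lambda> N else 0)" if i: "i \<in> {1..N - 1}" for i
  proof -
    have "row_mult (N - 1) (D_dagger N \<tau>) (\<lambda>j. \<Lambda> (j + 1)) (i + 1)
        = (\<Sum>j=1..N - 1. - (1 / w (i + 1)) *\<^sub>R (E j (i + 1) *\<^sub>R S j)
            + (if j = N - 1 then if i = N - 1 then (1 / w N) *\<^sub>R \<Lambda> N else 0 else 0))"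
      unfolding row_mult_def
    proof (rule sum.cong)
      fix j
      assume j: "j \<in> {1..N - 1}"
      have *: "i + 1 = N \<longleftrightarrow> i = N - 1" "i + 1 \<noteq> 1" "N - 1 + 1 = N"
        using i N by auto
      show "D_dagger N \<tau> (i + 1) j *\<^sub>R \<Lambda> (j + 1)
          = - (1 / w (i + 1)) *\<^sub>R (E j (i + 1) *\<^sub>R S j)
            + (if j = N - 1 then if i = N - 1 then (1 / w N) *\<^sub>R \<Lambda> N else 0 else 0)"
        using * unfolding D_dagger_def Let_def w[symmetric] E[symmetric] S_eq[OF j]
        by (auto simp: scaleR_left_distrib scaleR_left_diff_distrib mult.commute
            simp del: One_nat_def)
    qed simp
    also have "\<dots> = - (1 / w (i + 1)) *\<^sub>R row_mult (N - 1) (\<lambda>i j. E j (i + 1)) S i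
        + (if i = N - 1 then (1 / w N) *\<^sub>R \<Lambda> N else 0)"
      using N unfolding sum.distrib row_mult_def scaleR_sum_right by simp
    finally show ?thesis .
  qed

  \<comment> \<open>The shape common to all rows: \<open>l\<close> is the correction built into \<open>D_dagger\<close>, which occurs on
    both sides, and \<open>b\<close> is the boundary datum \<open>\<mu>\<close> or \<open>- grad \<Phi> (X N)\<close>, or 0 in inner rows.\<close>
  have scale: "- (1 / c) *\<^sub>R a + (1 / c) *\<^sub>R l = - g + (1 / c) *\<^sub>R (l + b)
      \<longleftrightarrow> a = c *\<^sub>R g - b" if "c \<noteq> 0" for c :: real and a b g l :: "real^'x"
  proof -
    have "- (1 / c) *\<^sub>R a + (1 / c) *\<^sub>R l = - g + (1 / c) *\<^sub>R (l + b)
        \<longleftrightarrow> - (1 / c) *\<^sub>R a = - g + (1 / c) *\<^sub>R b"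
      unfolding scaleR_right_distrib by (simp add: algebra_simps)
    also have "\<dots> \<longleftrightarrow> c *\<^sub>R (- (1 / c) *\<^sub>R a) = c *\<^sub>R (- g + (1 / c) *\<^sub>R b)"
      using that by (simp only: scaleR_cancel_left simp_thms)
    also have "\<dots> \<longleftrightarrow> - a = - (c *\<^sub>R g) + b"
      using that by (simp add: scaleR_right_distrib scaleR_right_diff_distrib)
    also have "\<dots> \<longleftrightarrow> a = c *\<^sub>R g - b"
      using neg_equal_iff_equal[of a "c *\<^sub>R g - b"] by simp
    finally show ?thesis .
  qed

  have row_1: "row_mult (N - 1) (D_dagger N \<tau>) (\<lambda>j. \<Lambda> (j + 1)) 1
        = - GX 1 + (if (1::nat) = 1 then (1 / w 1) *\<^sub>R (\<mu> - \<Lambda> 1) else 0)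
          + (if 1 = N then (1 / w N) *\<^sub>R (\<Lambda> N - grad \<Phi> (X N)) else 0)
      \<longleftrightarrow> (\<Sum>j=1..N - 1. E j 1 *\<^sub>R S j) = w 1 *\<^sub>R GX 1 - \<mu>"
    unfolding D_1
    using N scale[of "w 1" "\<Sum>j=1..N - 1. E j 1 *\<^sub>R S j" "- \<Lambda> 1" "GX 1" \<mu>] w_ne[of 1]
    by simp
  have row_i: "row_mult (N - 1) (D_dagger N \<tau>) (\<lambda>j. \<Lambda> (j + 1)) (i + 1)
        = - GX (i + 1) + (if i + 1 = 1 then (1 / w 1) *\<^sub>R (\<mu> - \<Lambda> 1) else 0)
          + (if i + 1 = N then (1 / w N) *\<^sub>R (\<Lambda> N - grad \<Phi> (X N)) else 0)
      \<longleftrightarrow> row_mult (N - 1) (\<lambda>i j. E j (i + 1)) S i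
          = w (i + 1) *\<^sub>R GX (i + 1) + (if i = N - 1 then grad \<Phi> (X N) else 0)"
    if i: "i \<in> {1..N - 1}" for i
  proof -
    have last: "i = N - 1 \<longleftrightarrow> i + 1 = N" and ne: "i + 1 \<noteq> 1" "w (i + 1) \<noteq> 0"
      using i N by (auto intro!: w_ne)
    note scale_i = scale[OF ne(2), of "row_mult (N - 1) (\<lambda>i j. E j (i + 1)) S i" _ "GX (i + 1)"]
    show ?thesis
    proof (cases "i + 1 = N")
      case True
      show ?thesis
        unfolding D_i[OF i] last using ne(1) scale_i[of "\<Lambda> N" "- grad \<Phi> (X N)"] True
        by (simp del: One_nat_def)
    next
      case False
      show ?thesis
        unfolding D_i[OF i] last using ne(1) scale_i[of 0 0] False
        by (simp del: One_nat_def)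
    qed
  qed
  have rows: "(\<forall>i\<in>{1..N}. P i) \<longleftrightarrow> P 1 \<and> (\<forall>i\<in>{1..N - 1}. P (i + 1))" for P
  proof -
    have "{1..N} = insert 1 ({1 + 1..N - 1 + 1})"
      using N by auto
    then have "{1..N} = insert 1 ((\<lambda>i. i + 1) ` {1..N - 1})"
      unfolding image_add_atLeastAtMost' .
    then show ?thesis
      by (simp only: ball_simps)
  qed

  have "(\<forall>i\<in>{1..N}.
          row_mult (N - 1) (D_dagger N \<tau>) (\<lambda>j. \<Lambda> (j + 1)) i
            = - matrix_grad (\<lambda>Y. frobenius N \<Lambda> (F_mat f Y U)) X i
              + (if i = 1 then (1 / w 1) *\<^sub>R (\<mu> - \<Lambda> 1) else 0)
              + (if i = N then (1 / w N) *\<^sub>R (\<Lambda> N - grad \<Phi> (X N)) else 0))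
      \<longleftrightarrow> (\<forall>i\<in>{1..N}.
          row_mult (N - 1) (D_dagger N \<tau>) (\<lambda>j. \<Lambda> (j + 1)) i
            = - GX i
              + (if i = 1 then (1 / w 1) *\<^sub>R (\<mu> - \<Lambda> 1) else 0)
              + (if i = N then (1 / w N) *\<^sub>R (\<Lambda> N - grad \<Phi> (X N)) else 0))"
    by (rule ball_cong) (simp_all only: grad_X')
  also have "\<dots> \<longleftrightarrow>
      (\<Sum>j=1..N - 1. E j 1 *\<^sub>R S j) = w 1 *\<^sub>R GX 1 - \<mu>
      \<and> (\<forall>i\<in>{1..N - 1}. row_mult (N - 1) (\<lambda>i j. E j (i + 1)) S i
          = w (i + 1) *\<^sub>R GX (i + 1) + (if i = N - 1 then grad \<Phi> (X N) else 0))"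
    unfolding rows row_1 by (rule conj_cong[OF refl], rule ball_cong[OF refl], rule row_i)
  also have "\<dots> \<longleftrightarrow>
      (\<Sum>j=1..N - 1. E j 1 *\<^sub>R S j)
        = matrix_grad (\<lambda>Y. frobenius (N - 1) S (\<lambda>j. \<alpha> j *\<^sub>R F_mat f Y U 1)) X 1 - \<mu>
      \<and> (\<forall>i\<in>{1..N - 1}.
          row_mult (N - 1) (\<lambda>i j. E j (i + 1)) S i
            = matrix_grad (\<lambda>Y. frobenius (N - 1) S (\<lambda>j. F_mat f Y U (j + 1))) X (i + 1)
              + (if i = N - 1 then grad \<Phi> (X N) else 0))"
    unfolding grad_X_1
    by (rule conj_cong[OF refl], rule ball_cong[OF refl]) (simp only: grad_X)
  finally have state_equations: "(\<forall>i\<in>{1..N}.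
          row_mult (N - 1) (D_dagger N \<tau>) (\<lambda>j. \<Lambda> (j + 1)) i
            = - matrix_grad (\<lambda>Y. frobenius N \<Lambda> (F_mat f Y U)) X i
              + (if i = 1 then (1 / w 1) *\<^sub>R (\<mu> - \<Lambda> 1) else 0)
              + (if i = N then (1 / w N) *\<^sub>R (\<Lambda> N - grad \<Phi> (X N)) else 0))
      \<longleftrightarrow> (\<Sum>j=1..N - 1. E j 1 *\<^sub>R S j)
        = matrix_grad (\<lambda>Y. frobenius (N - 1) S (\<lambda>j. \<alpha> j *\<^sub>R F_mat f Y U 1)) X 1 - \<mu>
      \<and> (\<forall>i\<in>{1..N - 1}.
          row_mult (N - 1) (\<lambda>i j. E j (i + 1)) S i
            = matrix_grad (\<lambda>Y. frobenius (N - 1) S (\<lambda>j. F_mat f Y U (j + 1))) X (i + 1)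
              + (if i = N - 1 then grad \<Phi> (X N) else 0))" .
  have control_equations: "(\<forall>i\<in>{1..N}.
          0 = matrix_grad (\<lambda>V. frobenius (N - 1) S (row_mult N (col_id \<alpha>) (F_mat f X V))) U i)
      \<longleftrightarrow> (\<forall>i\<in>{1..N}. 0 = matrix_grad (\<lambda>V. frobenius N \<Lambda> (F_mat f X V)) U i)"
    by (rule ball_cong[OF refl]) (simp add: grad_U grad_U' w_ne del: One_nat_def)
  show ?thesis
    unfolding state_equations control_equations by blast
qed

end
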